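(* Let $m,b$ be positive integers, let $L=m^b-(m-1)^b$ and $t_j=m^{b-j}(m-1)^{j-1}$ for $j=1,\dots,b$. The first-stage algorithm for sand that, given total amount $P>0$, outputs bag sizes $a_j=t_j\,P/L$ for $j=1,\dots,b$, is $\overline{\rho}(m,b)$-robust, where $$\overline{\rho}(m,b)=\frac{m^b}{m^b-(m-1)^b}=\frac{1}{1-\left(1-\frac1m\right)^b}.$$
   Context: Speed-robust scheduling of sand (infinitesimally small jobs): In the first stage, the algorithm receives only positive integers $m$ (number of machines), $b$ (number of bags) and a real $P>0$ (total processing volume), and outputs non-negative reals $a_1,\dots,a_b$ (bag sizes) with $\sum_j a_j=P$. In the second stage, speeds $s_1,\dots,s_m\ge0$ (not all zero) are revealed and each bag is assigned as a whole to a machine (a speed-$0$ machine receives no bags); machine $i$ with bag set $M_i$ has completion time $(\sum_{j\in M_i}a_j)/s_i$ (or $0$ if $s_i=0$), and the makespan $C_{\max}$ is the maximum completion time. Since the volume can be divided arbitrarily, the optimal (adversary's) makespan is $C^*_{\max}=P/\sum_{i=1}^m s_i$. The algorithm is $\rho$-robust if for every $P$ and every choice of speeds there is an assignment of bags with $C_{\max}\le\rho\,C^*_{\max}$. *)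

theory Defs
  imports Complex_Main "HOL-Library.FuncSet"
begin

definition valid_speeds :: "nat \<Rightarrow> (nat \<Rightarrow> real) \<Rightarrow> bool" where
  "valid_speeds m s \<longleftrightarrow> (\<forall>i\<in>{1..m}. s i \<ge> 0) \<and> (\<exists>i\<in>{1..m}. s i \<noteq> 0)"

definition completion_time :: "real \<Rightarrow> real \<Rightarrow> real" where
  "completion_time load speed = (if speed = 0 then 0 else load / speed)"

definition makespan :: "nat \<Rightarrow> (nat \<Rightarrow> real) \<Rightarrow> (nat \<Rightarrow> real) \<Rightarrow> real" where
  "makespan m s load = Max ((\<lambda>i. completion_time (load i) (s i)) ` {1..m})"

text \<open>The adversary distributes the sand itself, so a schedule is any division of the volume
  \<open>P\<close> into machine loads.\<close>

definition sand_divisions :: "nat \<Rightarrow> (nat \<Rightarrow> real) \<Rightarrow> real \<Rightarrow> (nat \<Rightarrow> real) set" where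
  "sand_divisions m s P =
     {x. (\<forall>i\<in>{1..m}. x i \<ge> 0) \<and> (\<forall>i\<in>{1..m}. s i = 0 \<longrightarrow> x i = 0) \<and> (\<Sum>i=1..m. x i) = P}"

definition opt_makespan :: "nat \<Rightarrow> (nat \<Rightarrow> real) \<Rightarrow> real \<Rightarrow> real" where
  "opt_makespan m s P = Inf (makespan m s ` sand_divisions m s P)"

lemma opt_makespan_eq:
  assumes s: "valid_speeds m s" and P: "P \<ge> 0"
  shows "opt_makespan m s P = P / (\<Sum>i=1..m. s i)"
proof -
  define S where "S = (\<Sum>i=1..m. s i)"
  have m: "{1..m} \<noteq> {}" using s by (auto simp: valid_speeds_def)
  have nn: "s i \<ge> 0" if "i \<in> {1..m}" for i using s that by (auto simp: valid_speeds_def)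
  obtain k where k: "k \<in> {1..m}" "s k \<noteq> 0" using s by (auto simp: valid_speeds_def)
  have "s k > 0" using nn[OF k(1)] k(2) by simp
  then have S: "S > 0" unfolding S_def using nn k(1) by (intro sum_pos2[of _ k]) auto
  have lower: "P / S \<le> makespan m s x" if x: "x \<in> sand_divisions m s P" for x
  proof -
    have c: "x i \<le> makespan m s x * s i" if i: "i \<in> {1..m}" for i
    proof (cases "s i = 0")
      case True
      then show ?thesis using x i by (auto simp: sand_divisions_def)
    next
      case False
      have "x i / s i = completion_time (x i) (s i)" using False by (simp add: completion_time_def)
      also have "\<dots> \<le> makespan m s x" unfolding makespan_def using i by (intro Max_ge) auto
      finally show ?thesis using False nn[OF i] by (simp add: pos_divide_le_eq)
    qed
    have "P = (\<Sum>i=1..m. x i)" using x by (simp add: sand_divisions_def)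
    also have "\<dots> \<le> (\<Sum>i=1..m. makespan m s x * s i)" by (intro sum_mono c)
    also have "\<dots> = makespan m s x * S" by (simp add: S_def sum_distrib_left)
    finally show ?thesis using S by (simp add: pos_divide_le_eq)
  qed
  define y where "y = (\<lambda>i. P * s i / S)"
  have "(\<Sum>i=1..m. y i) = P * S / S"
    unfolding y_def S_def by (simp add: sum_distrib_left sum_divide_distrib)
  then have y: "y \<in> sand_divisions m s P"
    using S P nn by (auto simp: sand_divisions_def y_def)
  have "makespan m s y \<le> P / S"
    unfolding makespan_def
  proof (rule Max.boundedI)
    show "c \<le> P / S" if "c \<in> (\<lambda>i. completion_time (y i) (s i)) ` {1..m}" for c
      using that S P by (auto simp: completion_time_def y_def)
  qed (use m in auto)
  then have "makespan m s y = P / S" using lower[OF y] by simp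
  then have "P / S \<in> makespan m s ` sand_divisions m s P" using y by force
  then show ?thesis unfolding opt_makespan_def S_def[symmetric]
    by (intro cInf_eq_minimum) (auto intro: lower)
qed

text \<open>A first-stage algorithm maps the numbers of machines and bags and the volume to the sizes of
  the bags \<open>1, \<dots>, b\<close>.\<close>

type_synonym first_stage = "nat \<Rightarrow> nat \<Rightarrow> real \<Rightarrow> nat \<Rightarrow> real"

definition valid_first_stage :: "first_stage \<Rightarrow> nat \<Rightarrow> nat \<Rightarrow> bool" where
  "valid_first_stage A m b \<longleftrightarrow>
     (\<forall>P>0. (\<forall>j\<in>{1..b}. A m b P j \<ge> 0) \<and> (\<Sum>j=1..b. A m b P j) = P)"

definition bag_assignments :: "nat \<Rightarrow> nat \<Rightarrow> (nat \<Rightarrow> real) \<Rightarrow> (nat \<Rightarrow> nat) set" where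
  "bag_assignments m b s = {f \<in> {1..b} \<rightarrow> {1..m}. \<forall>j\<in>{1..b}. s (f j) \<noteq> 0}"

definition bag_load :: "nat \<Rightarrow> (nat \<Rightarrow> real) \<Rightarrow> (nat \<Rightarrow> nat) \<Rightarrow> nat \<Rightarrow> real" where
  "bag_load b a f i = (\<Sum>j | j \<in> {1..b} \<and> f j = i. a j)"

definition robust :: "first_stage \<Rightarrow> nat \<Rightarrow> nat \<Rightarrow> real \<Rightarrow> bool" where
  "robust A m b \<rho> \<longleftrightarrow> valid_first_stage A m b \<and>
     (\<forall>P>0. \<forall>s. valid_speeds m s \<longrightarrow>
        (\<exists>f\<in>bag_assignments m b s.
           makespan m s (bag_load b (A m b P) f) \<le> \<rho> * opt_makespan m s P))"

definition sand_L :: "nat \<Rightarrow> nat \<Rightarrow> real" where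
  "sand_L m b = real m ^ b - (real m - 1) ^ b"

definition sand_t :: "nat \<Rightarrow> nat \<Rightarrow> nat \<Rightarrow> real" where
  "sand_t m b j = real m ^ (b - j) * (real m - 1) ^ (j - 1)"

definition sand_algorithm :: first_stage where
  "sand_algorithm m b P j = sand_t m b j * P / sand_L m b"

definition rho_bar :: "nat \<Rightarrow> nat \<Rightarrow> real" where
  "rho_bar m b = real m ^ b / (real m ^ b - (real m - 1) ^ b)"

end

(* Give machine i the capacity rho * P * s i / S, where S is the total speed. Assign the bags in
   order, each to a machine with the largest remaining capacity. In units of P / L the total capacity
   is m^b, and after n bags m^(b-n) (m-1)^n of it is left; by averaging over the machines some
   machine has at least 1/m of that left, which is exactly the size of the next bag. *)
theory Submission
  imports Defs
begin

lemma sum_bag_load: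
  assumes "finite I" and "f \<in> {1..n} \<rightarrow> I"
  shows "(\<Sum>i\<in>I. bag_load n a f i) = (\<Sum>j=1..n. a j)"
  unfolding bag_load_def using assms by (intro sum.group) auto

lemma bag_load_upd:
  "bag_load (Suc n) a (f(Suc n := k)) i = bag_load n a f i + (if i = k then a (Suc n) else 0)"
proof -
  have "{j \<in> {1..Suc n}. (f(Suc n := k)) j = i} =
      (if i = k then insert (Suc n) {j \<in> {1..n}. f j = i} else {j \<in> {1..n}. f j = i})"
    by auto
  then show ?thesis by (simp add: bag_load_def)
qed

text \<open>The hypothesis \<open>a\<close> bounds each bag by the average capacity still free over
  \<open>I\<close> when that bag arrives, so some machine can always take it. The total free
  capacity depends only on which bags have been placed, not on where.\<close>

lemma greedy_assignment:
  fixes a c :: "nat \<Rightarrow> real"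
  assumes I: "finite I" "I \<noteq> {}" and c: "\<And>i. i \<in> I \<Longrightarrow> c i \<ge> 0"
    and a: "\<And>j. j < n \<Longrightarrow> real (card I) * a (Suc j) \<le> sum c I - (\<Sum>k=1..j. a k)"
  shows "\<exists>f\<in>{1..n} \<rightarrow> I. \<forall>i\<in>I. bag_load n a f i \<le> c i"
  using a
proof (induction n)
  case 0
  then show ?case using c by (auto simp: bag_load_def)
next
  case (Suc n)
  then obtain f where f: "f \<in> {1..n} \<rightarrow> I" "\<forall>i\<in>I. bag_load n a f i \<le> c i"
    by auto
  \<comment> \<open>Otherwise every machine would have less than \<open>a (Suc n)\<close> free, and
    summing over \<open>I\<close> would contradict the averaging hypothesis for
    \<open>j = n\<close>.\<close>
  have "\<exists>k\<in>I. a (Suc n) \<le> c k - bag_load n a f k"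
  proof (rule ccontr)
    assume "\<not> ?thesis"
    then have "(\<Sum>i\<in>I. c i - bag_load n a f i) < (\<Sum>i\<in>I. a (Suc n))"
      using I by (intro sum_strict_mono) auto
    then show False
      using Suc.prems[of n] sum_bag_load[OF I(1) f(1), of a] by (simp add: sum_subtractf)
  qed
  then obtain k where "k \<in> I" "a (Suc n) \<le> c k - bag_load n a f k" by auto
  with f have "f(Suc n := k) \<in> {1..Suc n} \<rightarrow> I"
      "\<forall>i\<in>I. bag_load (Suc n) a (f(Suc n := k)) i \<le> c i"
    unfolding bag_load_upd by (auto simp: Pi_iff)
  then show ?case by blast
qed

text \<open>The sum telescopes: since m - (m-1) = 1, t_j = m^(b-j+1) (m-1)^(j-1) - m^(b-j)
  (m-1)^j.\<close>

lemma sum_sand_t: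
  assumes "n \<le> b"
  shows "(\<Sum>j=1..n. sand_t m b j) = real m ^ b - real m ^ (b - n) * (real m - 1) ^ n"
  using assms
proof (induction n)
  case (Suc n)
  then have "real m ^ (b - n) = real m * real m ^ (b - Suc n)"
    by (metis Suc_diff_Suc Suc_le_lessD power_Suc)
  with Suc show ?case by (simp add: sand_t_def algebra_simps)
qed simp

lemma sand_L_pos:
  assumes "m \<ge> 1" and "b \<ge> 1"
  shows "sand_L m b > 0"
  using assms by (auto simp: sand_L_def intro!: power_strict_mono)

lemma sum_sand_algorithm:
  assumes "n \<le> b"
  shows "(\<Sum>j=1..n. sand_algorithm m b P j)
    = (real m ^ b - real m ^ (b - n) * (real m - 1) ^ n) * P / sand_L m b"
  using sum_sand_t[OF assms, of m]
  by (simp add: sand_algorithm_def flip: sum_distrib_right sum_divide_distrib)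

lemma sand_algorithm_nonneg:
  assumes "m \<ge> 1" "b \<ge> 1" "P \<ge> 0"
  shows "sand_algorithm m b P j \<ge> 0"
  using assms sand_L_pos[of m b] by (simp add: sand_algorithm_def sand_t_def)

text \<open>Both sides equal m^(b-n) (m-1)^n P / L. Hence the greedy condition holds with equality
  when all m machines are available.\<close>

lemma sand_algorithm_Suc:
  assumes "n < b"
  shows "real m * sand_algorithm m b P (Suc n)
    = rho_bar m b * P - (\<Sum>j=1..n. sand_algorithm m b P j)"
proof -
  have "real m ^ (b - n) = real m * real m ^ (b - Suc n)"
    using assms by (metis Suc_diff_Suc power_Suc)
  moreover have "rho_bar m b * P = real m ^ b * P / sand_L m b"
    by (simp add: rho_bar_def sand_L_def)
  ultimately show ?thesis
    unfolding sum_sand_algorithm[OF less_imp_le[OF assms]]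
    by (simp add: sand_algorithm_def sand_t_def algebra_simps flip: diff_divide_distrib)
qed

lemma robust_sand_algorithm:
  assumes m: "m \<ge> 1" and b: "b \<ge> 1"
  shows "robust sand_algorithm m b (rho_bar m b)"
  unfolding robust_def
proof (intro conjI allI impI)
  have "(\<Sum>j=1..b. sand_algorithm m b P j) = P" for P
    using sum_sand_algorithm[of b b m P] sand_L_pos[OF m b] by (simp add: sand_L_def)
  then show "valid_first_stage sand_algorithm m b"
    using sand_algorithm_nonneg[OF m b] by (auto simp: valid_first_stage_def)
next
  fix P :: real and s assume P: "P > 0" and s: "valid_speeds m s"
  define S where "S = (\<Sum>i=1..m. s i)"
  \<comment> \<open>Machines of speed 0 may not receive bags, so the greedy argument runs on
    \<open>I\<close> only; the total speed is unaffected.\<close>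
  define I where "I = {i \<in> {1..m}. s i \<noteq> 0}"
  define R where "R = rho_bar m b * opt_makespan m s P"
  have I: "finite I" "I \<noteq> {}" and nn: "\<And>i. i \<in> {1..m} \<Longrightarrow> s i \<ge> 0"
    using s by (auto simp: I_def valid_speeds_def)
  have SI: "sum s I = S"
    unfolding S_def I_def by (rule sum.mono_neutral_left) auto
  have S: "S > 0"
    unfolding SI[symmetric] using I nn by (intro sum_pos) (auto simp: I_def less_le)
  have R_eq: "R = rho_bar m b * P / S"
    using opt_makespan_eq[OF s] P by (simp add: R_def S_def)
  have R: "R \<ge> 0"
    using sand_L_pos[OF m b] S P by (simp add: R_eq rho_bar_def flip: sand_L_def)
  have cap: "(\<Sum>i\<in>I. R * s i) = rho_bar m b * P"
    unfolding sum_distrib_left[symmetric] SI using S by (simp add: R_eq)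
  have "card I \<le> card {1..m}"
    unfolding I_def by (intro card_mono) auto
  then have cardI: "real (card I) \<le> real m" by simp
  have "\<exists>f\<in>{1..b} \<rightarrow> I. \<forall>i\<in>I. bag_load b (sand_algorithm m b P) f i \<le> R * s i"
  proof (rule greedy_assignment[OF I])
    show "0 \<le> R * s i" if "i \<in> I" for i
      using that R nn by (simp add: I_def)
  next
    fix j assume "j < b"
    \<comment> \<open>Having fewer usable machines does no harm: the total capacity stays
      \<open>rho_bar m b * P\<close>, while the average is taken over at most \<open>m\<close>
      machines.\<close>
    have "real (card I) * sand_algorithm m b P (Suc j) \<le> real m * sand_algorithm m b P (Suc j)"
      using cardI P by (intro mult_right_mono sand_algorithm_nonneg m b) auto
    then show "real (card I) * sand_algorithm m b P (Suc j)
        \<le> (\<Sum>i\<in>I. R * s i) - (\<Sum>k=1..j. sand_algorithm m b P k)"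
      by (simp add: cap sand_algorithm_Suc[OF \<open>j < b\<close>])
  qed
  then obtain f where f: "f \<in> {1..b} \<rightarrow> I"
    and load: "\<And>i. i \<in> I \<Longrightarrow> bag_load b (sand_algorithm m b P) f i \<le> R * s i" by auto
  \<comment> \<open>Outside \<open>I\<close> the completion time is 0 by convention, and the bound
    is just \<open>R \<ge> 0\<close>.\<close>
  have "completion_time (bag_load b (sand_algorithm m b P) f i) (s i) \<le> R" if "i \<in> {1..m}" for i
    using that load[of i] nn[of i] R by (auto simp: completion_time_def I_def pos_divide_le_eq)
  then have "makespan m s (bag_load b (sand_algorithm m b P) f) \<le> R"
    unfolding makespan_def using m by (intro Max.boundedI) auto
  moreover have "f \<in> bag_assignments m b s"
    using f by (auto simp: bag_assignments_def I_def)
  ultimately show "\<exists>f\<in>bag_assignments m b s. makespan m s (bag_load b (sand_algorithm m b P) f)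
      \<le> rho_bar m b * opt_makespan m s P"
    unfolding R_def by blast
qed

lemma rho_bar_eq:
  assumes "m \<ge> 1"
  shows "rho_bar m b = 1 / (1 - (1 - 1 / real m) ^ b)"
proof -
  have "1 - 1 / real m = (real m - 1) / real m"
    using assms by (simp add: diff_divide_distrib)
  then have "1 - (1 - 1 / real m) ^ b = (real m ^ b - (real m - 1) ^ b) / real m ^ b"
    using assms by (simp only: power_divide) (simp add: diff_divide_distrib)
  then show ?thesis by (simp add: rho_bar_def)
qed

theorem theorem3:
  fixes m b :: nat
  assumes "m \<ge> 1" and "b \<ge> 1"
  shows "robust sand_algorithm m b (rho_bar m b)
    \<and> rho_bar m b = 1 / (1 - (1 - 1 / real m) ^ b)"
  using robust_sand_algorithm[OF assms] rho_bar_eq[OF assms(1)] by blast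

end
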